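(* (a) Let $(b_n)_{n\ge1}$ be a sequence in $(1,\infty)$. Then \[ \lambda(\{\mathsf a'_n>b_n\text{ for infinitely many }n\})=\begin{cases}1&\text{if }\sum_{n\ge1}\frac{1}{b_n\log b_n}=\infty,\\ 0&\text{otherwise.}\end{cases} \] (b) If moreover $(b_n)$ is non-decreasing, then \[ \lambda(\{\mathsf a'_n>b_n\text{ i.o.}\})=\lambda(\{\mathsf M'_n>b_n\text{ i.o.}\}). \]
   Context: $I=(0,1]$, $\lambda$ is Lebesgue measure on $I$, and $\mathsf a_n(x)$ denotes the $n$-th continued fraction digit of $x\in I$, i.e. $x=[\mathsf a_1(x),\mathsf a_2(x),\dots]=1/(\mathsf a_1(x)+1/(\mathsf a_2(x)+\cdots))$. $\mathbb P$ is the set of primes. The prime digits are $\mathsf a'_n(x):=\mathsf a_n(x)$ if $\mathsf a_n(x)\in\mathbb P$ and $\mathsf a'_n(x):=0$ otherwise. $\mathsf M'_n:=\max_{1\le k\le n}\mathsf a'_k$. "i.o." means "for infinitely many $n$". *)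

theory Defs
  imports "HOL-Analysis.Analysis" "HOL-Computational_Algebra.Primes"
begin

text \<open>Gauss map on (0,1]: T x = 1/x - floor(1/x) (with 1/0 = 0 in HOL, irrelevant a.e.).\<close>
definition gauss_map :: "real \<Rightarrow> real" where
  "gauss_map x = frac (1 / x)"

definition cf_digit :: "nat \<Rightarrow> real \<Rightarrow> nat" where
  "cf_digit n x = nat \<lfloor>1 / (gauss_map ^^ (n - 1)) x\<rfloor>"

definition cf_prime_digit :: "nat \<Rightarrow> real \<Rightarrow> nat" where
  "cf_prime_digit n x = (if prime (cf_digit n x) then cf_digit n x else 0)"

definition cf_prime_max :: "nat \<Rightarrow> real \<Rightarrow> nat" where
  "cf_prime_max n x = Max ((\<lambda>k. cf_prime_digit k x) ` {1..n})"

end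

theory Submission
  imports Defs "HOL-Real_Asymp.Real_Asymp"
begin

text \<open>
  Conditionally on the first $n$ digits, $T^n x$ has density
  $(1+\theta)/(1+\theta y)^2$ on $(0,1]$ with $\theta = q_{n-1}/q_n \in [0,1]$, so the digits are
  driven by a Markov chain on $\theta$ whose step $\theta \mapsto 1/(k+\theta)$ has probability
  $(1+\theta)/((k+\theta)(k+1+\theta))$, which lies between $1/(6k^2)$ and $2/k^2$. By Chebyshev's
  bounds on $\sum_{p \le x} \log p$, the probability of a prime digit above $t$ is therefore of
  order $\min(1, 1/(t \log t))$ uniformly in the past. The convergent case is the first
  Borel--Cantelli lemma; in the divergent case the probability of missing all large primes from some
  position on is at most $\prod (1 - c \min(1, 1/(b_n \log b_n))) = 0$, without any zero-one law. For
  (b), if $b_n \to \infty$ the two events coincide, and if $b_n$ stays bounded both have measure 1.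
\<close>

section \<open>Chebyshev's bounds\<close>

definition theta :: "nat \<Rightarrow> real" where
  "theta n = (\<Sum>p | prime p \<and> p \<le> n. ln (real p))"

lemma theta_0 [simp]: "theta 0 = 0"
  by (auto simp: theta_def intro!: sum.neutral)

lemma theta_Suc: "theta (Suc n) = (if prime (Suc n) then ln (real (Suc n)) else 0) + theta n"
proof (cases "prime (Suc n)")
  case True
  have "{p. prime p \<and> p \<le> Suc n} = insert (Suc n) {p. prime p \<and> p \<le> n}"
    using True by (auto simp: le_Suc_eq)
  then show ?thesis using True by (simp add: theta_def)
next
  case False
  then have "{p. prime p \<and> p \<le> Suc n} = {p. prime p \<and> p \<le> n}"
    using le_Suc_eq by blast
  then show ?thesis using False by (simp add: theta_def)
qed

lemma theta_diff:
  assumes "m \<le> n"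
  shows "theta n - theta m = (\<Sum>p | prime p \<and> m < p \<and> p \<le> n. ln (real p))"
proof -
  have eq: "{p. prime p \<and> p \<le> n} = {p. prime p \<and> p \<le> m} \<union> {p. prime p \<and> m < p \<and> p \<le> n}"
    using assms by auto
  show ?thesis unfolding theta_def eq
    by (subst sum.union_disjoint) auto
qed

text \<open>Every prime p with m + 1 < p <= 2m + 1 divides (2m + 1)! but neither m! nor (m + 1)!, so
  it divides the binomial coefficient. That coefficient occurs twice in a row with sum 2 * 4^m,
  hence the product of these primes is at most 4^m.\<close>

lemma theta_le_double:
  assumes "m > 0"
  shows "theta (2 * m + 1) - theta (m + 1) \<le> real m * ln 4"
proof -
  let ?P = "{p. prime p \<and> m + 1 < p \<and> p \<le> 2 * m + 1}"
  let ?B = "(2 * m + 1) choose m"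
  have dvd: "p dvd ?B" if "p \<in> ?P" for p
  proof -
    have p: "prime p" "p > m + 1" "p \<le> 2 * m + 1" using that by auto
    have "(fact (2 * m + 1) :: nat) = fact m * fact (m + 1) * ?B"
      using binomial_fact_lemma[of m "2 * m + 1"] by (simp add: mult_2)
    moreover have "p dvd fact (2 * m + 1)" "\<not> p dvd fact m" "\<not> p dvd fact (m + 1)"
      using p by (auto simp: prime_dvd_fact_iff simp del: fact_Suc)
    ultimately show ?thesis
      using p(1) by (metis prime_dvd_mult_iff)
  qed
  have "(\<Prod>p\<in>?P. p) dvd ?B"
  proof -
    have "(\<Prod>p\<in>Q. p) dvd ?B" if "finite Q" "Q \<subseteq> ?P" for Q
      using that
    proof (induction Q rule: finite_induct)
      case (insert q Q)
      have "coprime q (\<Prod>p\<in>Q. p)"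
        using insert by (intro prod_coprime_right) (auto intro: primes_coprime)
      then show ?case using insert dvd[of q]
        by (auto intro: divides_mult)
    qed auto
    then show ?thesis by simp
  qed
  then have "(\<Prod>p\<in>?P. p) \<le> ?B"
    by (rule dvd_imp_le) simp
  also have "?B \<le> 4 ^ m"
  proof -
    have "2 * ?B = (\<Sum>k\<in>{m, Suc m}. (2 * m + 1) choose k)"
      using central_binomial_odd[of "2 * m + 1"] by simp
    also have "\<dots> \<le> (\<Sum>k\<le>2 * m + 1. (2 * m + 1) choose k)"
      using assms by (intro sum_mono2) auto
    also have "\<dots> = 2 * 4 ^ m"
      by (subst choose_row_sum) (simp add: power_mult)
    finally show ?thesis by simp
  qed
  finally have le: "(\<Prod>p\<in>?P. p) \<le> 4 ^ m" .
  have pos: "(\<Prod>p\<in>?P. p) > 0" by (auto intro!: prod_pos simp: prime_gt_0_nat)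
  have "theta (2 * m + 1) - theta (m + 1) = (\<Sum>p\<in>?P. ln (real p))"
    by (subst theta_diff) auto
  also have "\<dots> = ln (real (\<Prod>p\<in>?P. p))"
    unfolding of_nat_prod by (rule ln_prod [symmetric]) (auto simp: prime_gt_0_nat)
  also have "\<dots> \<le> ln (real (4 ^ m))"
    using le pos by (subst ln_le_cancel_iff; (subst of_nat_le_iff | subst of_nat_0_less_iff); simp)
  also have "\<dots> = real m * ln 4" by (simp add: ln_realpow)
  finally show ?thesis .
qed

text \<open>Strong induction: an even n > 2 is not prime and adds nothing, while for n = 2m + 1 the
  range splits at m + 1, where the bounds (m + 1) ln 4 and m ln 4 add up to n ln 4.\<close>

lemma theta_upper: "theta n \<le> real n * ln 4"
proof (induction n rule: less_induct)
  case (less n)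
  consider "n = 0" | "n = 1" | "n = 2" | "n > 2" "even n" | "n > 2" "odd n" by linarith
  then show ?case
  proof cases
    case 1
    then show ?thesis by simp
  next
    case 2
    then show ?thesis by (simp add: theta_Suc)
  next
    case 3
    have "theta 2 = ln 2"
      using two_is_prime_nat by (simp add: numeral_2_eq_2 theta_Suc del: two_is_prime_nat)
    moreover have "ln (4 :: real) = 2 * ln 2" using ln_realpow[of 2 2] by simp
    ultimately show ?thesis using 3 by simp
  next
    case 4
    then have "\<not> prime n" using prime_odd_nat by auto
    then have "theta n = theta (n - 1)" using 4 theta_Suc[of "n - 1"] by simp
    also have "\<dots> \<le> real (n - 1) * ln 4" using 4 by (intro less.IH) auto
    also have "\<dots> \<le> real n * ln 4" by (intro mult_right_mono) auto
    finally show ?thesis .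
  next
    case 5
    then obtain m where m: "n = 2 * m + 1" by (auto elim: oddE)
    have "theta (m + 1) \<le> real (m + 1) * ln 4" using 5 m by (intro less.IH) auto
    moreover have "theta (2 * m + 1) - theta (m + 1) \<le> real m * ln 4"
      using 5 m by (intro theta_le_double) auto
    ultimately show ?thesis by (simp add: m algebra_simps)
  qed
qed

section \<open>Lower bound for \<open>theta\<close> from the central binomial coefficient\<close>

text \<open>Legendre's formula, cut off at any r with n < p^r. Passing to n + 1 raises the i-th
  quotient by one exactly when p^i divides n + 1, and the multiplicity of p in n + 1 counts these
  i.\<close>

lemma multiplicity_fact:
  assumes p: "prime (p::nat)" and "n < p ^ r"
  shows "multiplicity p (fact n :: nat) = (\<Sum>i=1..r. n div p ^ i)"
  using assms(2)
proof (induction n)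
  case (Suc n)
  have dvd_iff: "p ^ i dvd Suc n \<longleftrightarrow> i \<le> multiplicity p (Suc n)" for i
    using p by (intro power_dvd_iff_le_multiplicity) (auto simp: not_prime_unit)
  have "multiplicity p (Suc n) \<le> r"
  proof (rule ccontr)
    assume "\<not> ?thesis"
    then have "p ^ r dvd Suc n" using dvd_iff by simp
    with Suc.prems show False by (auto dest: dvd_imp_le)
  qed
  then have "{i\<in>{1..r}. p ^ i dvd Suc n} = {1..multiplicity p (Suc n)}"
    by (auto simp: dvd_iff)
  then have card: "(\<Sum>i=1..r. if p ^ i dvd Suc n then 1 else 0) = multiplicity p (Suc n)"
    by (simp flip: sum.inter_filter)
  have "multiplicity p (fact (Suc n) :: nat) = multiplicity p (Suc n) + multiplicity p (fact n :: nat)"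
    using p by (simp add: prime_elem_multiplicity_mult_distrib del: mult_Suc)
  also have "\<dots> = (\<Sum>i=1..r. (if p ^ i dvd Suc n then 1 else 0) + n div p ^ i)"
    using Suc card by (simp add: sum.distrib)
  also have "\<dots> = (\<Sum>i=1..r. Suc n div p ^ i)"
    by (intro sum.cong) (auto simp: div_Suc dvd_eq_mod_eq_0)
  finally show ?case .
qed (use p in simp)

text \<open>With e the multiplicity, suppose p^e > 2n. Legendre's formula then stops at e for both
  factorials, each term floor(2n/p^i) - 2 floor(n/p^i) is at most 1, and the term i = e is 0. This
  leaves e <= e - 1.\<close>

lemma prime_power_dvd_central_binomial_le:
  assumes p: "prime (p::nat)" and n: "n > 0"
  shows "p ^ multiplicity p ((2 * n) choose n) \<le> 2 * n"
proof (rule ccontr)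
  let ?B = "(2 * n) choose n"
  let ?e = "multiplicity p ?B"
  assume gt: "\<not> ?thesis"
  then have e0: "?e > 0" using n by (cases ?e) auto
  have lt: "2 * n < p ^ ?e" "n < p ^ ?e" using gt by auto
  have "(fact (2 * n) :: nat) = fact n * fact n * ?B"
    using binomial_fact_lemma[of n "2 * n"] by (simp add: mult_2)
  then have "multiplicity p (fact (2 * n) :: nat) = 2 * multiplicity p (fact n :: nat) + ?e"
    using p by (simp add: prime_elem_multiplicity_mult_distrib)
  then have "(\<Sum>i=1..?e. 2 * n div p ^ i) = 2 * (\<Sum>i=1..?e. n div p ^ i) + ?e"
    by (simp add: multiplicity_fact[OF p lt(1)] multiplicity_fact[OF p lt(2)])
  moreover have "(\<Sum>i=1..?e. 2 * n div p ^ i) = (\<Sum>i\<in>{1..<?e}. 2 * n div p ^ i) + 2 * n div p ^ ?e"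
    using e0 by (simp add: sum.last_plus)
  moreover have "2 * n div p ^ ?e = 0" using lt by simp
  moreover have "(\<Sum>i\<in>{1..<?e}. 2 * n div p ^ i) \<le> (\<Sum>i\<in>{1..<?e}. 2 * (n div p ^ i) + 1)"
  proof (intro sum_mono)
    fix i
    have "p ^ i > 0" using p by (simp add: prime_gt_0_nat)
    have "2 * n = (2 * (n div p ^ i)) * p ^ i + 2 * (n mod p ^ i)"
      by (metis div_mult_mod_eq distrib_left mult.assoc)
    also have "\<dots> < (2 * (n div p ^ i)) * p ^ i + 2 * p ^ i"
      using \<open>p ^ i > 0\<close> by simp
    also have "\<dots> = (2 * (n div p ^ i) + 2) * p ^ i" by (simp add: algebra_simps)
    finally have "2 * n div p ^ i < 2 * (n div p ^ i) + 2"
      using \<open>p ^ i > 0\<close> by (simp add: div_less_iff_less_mult)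
    then show "2 * n div p ^ i \<le> 2 * (n div p ^ i) + 1" by simp
  qed
  moreover have "(\<Sum>i\<in>{1..<?e}. 2 * (n div p ^ i) + 1) = 2 * (\<Sum>i\<in>{1..<?e}. n div p ^ i) + (?e - 1)"
    unfolding sum.distrib sum_distrib_left by simp
  moreover have "(\<Sum>i\<in>{1..<?e}. n div p ^ i) \<le> (\<Sum>i=1..?e. n div p ^ i)"
    by (intro sum_mono2) auto
  ultimately show False using e0 by linarith
qed

text \<open>The logarithm of the central binomial coefficient, at least n ln 4 - ln (2n), is split
  over primes. A prime with p^2 > 2n occurs at most once and costs at most ln p; each of the at most
  sqrt (2n) others costs at most ln (2n).\<close>

lemma theta_lower:
  assumes n: "n > 0"
  shows "theta (2 * n) \<ge> real n * ln 4 - ln (2 * real n) - sqrt (2 * real n) * ln (2 * real n)"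
proof -
  let ?B = "(2 * n) choose n"
  let ?e = "\<lambda>p. multiplicity p ?B"
  let ?F = "prime_factors ?B"
  let ?P = "{p. prime p \<and> p \<le> 2 * n}"
  let ?S = "{p. prime p \<and> p \<le> 2 * n \<and> p\<^sup>2 \<le> 2 * n}"
  have e: "real (?e p) * ln (real p) \<le> ln (2 * real n)" if "prime p" for p
  proof -
    have "real (p ^ ?e p) \<le> real (2 * n)"
      using prime_power_dvd_central_binomial_le[OF that n] of_nat_le_iff by blast
    then have "ln (real p ^ ?e p) \<le> ln (2 * real n)"
      using that prime_gt_0_nat[OF that] by (subst ln_le_cancel_iff) (use n in auto)
    then show ?thesis using prime_gt_0_nat[OF that] by (simp add: ln_realpow)
  qed
  have F: "?F \<subseteq> ?P"
  proof
    fix p assume "p \<in> ?F"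
    then have p: "prime p" "p dvd ?B" by (auto simp: prime_factors_dvd)
    then have "?e p > 0" by (simp add: prime_multiplicity_gt_zero_iff)
    then have "p \<le> p ^ ?e p" using p by (simp add: self_le_power prime_gt_0_nat Suc_leI)
    with prime_power_dvd_central_binomial_le[OF p(1) n] p show "p \<in> ?P" by simp
  qed
  have "4 ^ n / (2 * real n) \<le> real ?B" using n by (rule central_binomial_lower_bound)
  then have "ln (4 ^ n / (2 * real n)) \<le> ln (real ?B)"
    using n by (subst ln_le_cancel_iff) auto
  then have "real n * ln 4 - ln (2 * real n) \<le> ln (real ?B)"
    using n by (simp add: ln_div ln_realpow)
  also have "ln (real ?B) = ln (\<Prod>p\<in>?F. real p ^ ?e p)"
    by (subst prime_factorization_nat[of ?B]) (simp_all flip: of_nat_power of_nat_prod)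
  also have "\<dots> = (\<Sum>p\<in>?F. real (?e p) * ln (real p))"
    by (subst ln_prod) (auto simp: in_prime_factors_iff prime_gt_0_nat ln_realpow intro!: sum.cong)
  also have "\<dots> \<le> (\<Sum>p\<in>?P. real (?e p) * ln (real p))"
    using F by (intro sum_mono2) (auto simp: prime_gt_0_nat Suc_leI)
  also have "\<dots> \<le> (\<Sum>p\<in>?P. ln (real p) + (if p\<^sup>2 \<le> 2 * n then ln (2 * real n) else 0))"
  proof (intro sum_mono)
    fix p assume "p \<in> ?P"
    then have p: "prime p" by auto
    have lnp: "ln (real p) \<ge> 0" using prime_ge_1_nat[OF p] by simp
    show "real (?e p) * ln (real p) \<le> ln (real p) + (if p\<^sup>2 \<le> 2 * n then ln (2 * real n) else 0)"
    proof (cases "p\<^sup>2 \<le> 2 * n")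
      case True
      then show ?thesis using e[OF p] lnp by auto
    next
      case False
      have "?e p < 2"
      proof (rule ccontr)
        assume "\<not> ?e p < 2"
        then have "p\<^sup>2 \<le> p ^ ?e p" using prime_ge_1_nat[OF p] by (intro power_increasing) auto
        with False prime_power_dvd_central_binomial_le[OF p n] show False by simp
      qed
      then have "real (?e p) * ln (real p) \<le> 1 * ln (real p)"
        using lnp by (intro mult_right_mono) auto
      then show ?thesis using False by simp
    qed
  qed
  also have "\<dots> = theta (2 * n) + real (card ?S) * ln (2 * real n)"
    by (simp add: sum.distrib theta_def conj_assoc flip: sum.inter_filter)
  also have "real (card ?S) * ln (2 * real n) \<le> sqrt (2 * real n) * ln (2 * real n)"
  proof (intro mult_right_mono)
    have "?S \<subseteq> {1..nat \<lfloor>sqrt (2 * real n)\<rfloor>}"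
    proof
      fix p assume "p \<in> ?S"
      then have p: "prime p" "p\<^sup>2 \<le> 2 * n" by auto
      then have "(real p)\<^sup>2 \<le> 2 * real n"
        by (metis of_nat_le_iff of_nat_mult of_nat_numeral of_nat_power)
      then have "real p \<le> sqrt (2 * real n)" by (rule real_le_rsqrt)
      then show "p \<in> {1..nat \<lfloor>sqrt (2 * real n)\<rfloor>}"
        using prime_ge_1_nat[OF p(1)] by (simp add: le_nat_floor)
    qed
    then have "card ?S \<le> nat \<lfloor>sqrt (2 * real n)\<rfloor>"
      using card_mono[of "{1..nat \<lfloor>sqrt (2 * real n)\<rfloor>}" ?S] by simp
    moreover have "real (nat \<lfloor>sqrt (2 * real n)\<rfloor>) \<le> sqrt (2 * real n)" by simp
    ultimately show "real (card ?S) \<le> sqrt (2 * real n)"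
      by (meson of_nat_le_iff order_trans)
    show "ln (2 * real n) \<ge> 0" using n by simp
  qed
  finally show ?thesis by simp
qed

section \<open>Sums of inverse squares of large primes\<close>

text \<open>Partial summation, arranged as an induction on N. The boundary term is carried along, so
  that each step only has to estimate \<open>theta n\<close> times 1/n^2 - 1/(n + 1)^2; by
  \<open>theta_upper\<close> this is dominated by a telescoping term.\<close>

lemma sum_ln_primes_over_square:
  assumes "M > 0" "M \<le> N"
  shows "(\<Sum>p | prime p \<and> M < p \<and> p \<le> N. ln (real p) / (real p)\<^sup>2)
           \<le> theta N / (real N)\<^sup>2 + 2 * ln 4 * (1 / real M - 1 / real N)"
  using assms(2)
proof (induction N rule: dec_induct)
  case base
  have "theta M \<ge> 0"
    unfolding theta_def by (intro sum_nonneg) (auto dest: prime_ge_1_nat)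
  moreover have "{p. prime p \<and> M < p \<and> p \<le> M} = {}" by auto
  ultimately show ?case by (simp only:) simp
next
  case (step n)
  let ?t = "if prime (Suc n) then ln (real (Suc n)) / (real (Suc n))\<^sup>2 else 0"
  have n: "real n > 0" using step assms by simp
  have "(\<Sum>p | prime p \<and> M < p \<and> p \<le> Suc n. ln (real p) / (real p)\<^sup>2)
      = ?t + (\<Sum>p | prime p \<and> M < p \<and> p \<le> n. ln (real p) / (real p)\<^sup>2)"
  proof (cases "prime (Suc n)")
    case True
    have "{p. prime p \<and> M < p \<and> p \<le> Suc n} = insert (Suc n) {p. prime p \<and> M < p \<and> p \<le> n}"
      using True step by (auto simp: le_Suc_eq)
    then show ?thesis using True by simp
  next
    case False
    then have "{p. prime p \<and> M < p \<and> p \<le> Suc n} = {p. prime p \<and> M < p \<and> p \<le> n}"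
      using le_Suc_eq by blast
    then show ?thesis using False by simp
  qed
  also have "\<dots> \<le> ?t + theta n / (real n)\<^sup>2 + 2 * ln 4 * (1 / real M - 1 / real n)"
    using step.IH by simp
  also have "theta n / (real n)\<^sup>2 = theta n * (1 / (real n)\<^sup>2 - 1 / (real (Suc n))\<^sup>2) + theta n / (real (Suc n))\<^sup>2"
    by (simp add: algebra_simps)
  also have "theta n * (1 / (real n)\<^sup>2 - 1 / (real (Suc n))\<^sup>2)
               \<le> (real n * ln 4) * (1 / (real n)\<^sup>2 - 1 / (real (Suc n))\<^sup>2)"
    using n by (intro mult_right_mono theta_upper) (auto simp: frac_le power_mono)
  also have "\<dots> = ln 4 * (real n * (1 / (real n)\<^sup>2 - 1 / (real (Suc n))\<^sup>2))"
    by simp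
  also have "\<dots> \<le> ln 4 * (2 * (1 / real n - 1 / real (Suc n)))"
  proof (intro mult_left_mono)
    show "real n * (1 / (real n)\<^sup>2 - 1 / (real (Suc n))\<^sup>2) \<le> 2 * (1 / real n - 1 / real (Suc n))"
    proof -
      \<comment> \<open>The difference of the two sides is an explicit positive quantity.\<close>
      have "2 * (1 / x - 1 / (x + 1)) - x * (1 / x\<^sup>2 - 1 / (x + 1)\<^sup>2) = 1 / (x * (x + 1)\<^sup>2)"
        if "x > 0" for x :: real
        using that by (simp add: divide_simps) (simp add: algebra_simps power2_eq_square)
      from this[of "real n"] n
      have "2 * (1 / real n - 1 / (real n + 1)) - real n * (1 / (real n)\<^sup>2 - 1 / (real n + 1)\<^sup>2) \<ge> 0"
        by (simp only:) simp
      then show ?thesis by (simp add: add.commute)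
    qed
  qed simp
  finally show ?case
    by (simp add: theta_Suc algebra_simps add_divide_distrib split: if_splits)
qed

text \<open>Weighting by ln t <= ln p reduces the claim to the logarithmic sum, whose tail beyond
  the floor of t is of order 1/t.\<close>

lemma sum_primes_inverse_square_upper:
  assumes t: "t > (1::real)"
  shows "(\<Sum>p | prime p \<and> t < real p \<and> p \<le> N. 1 / (real p)\<^sup>2) \<le> 4 * ln 4 / (t * ln t)"
proof -
  define M where "M = nat \<lfloor>t\<rfloor>"
  have M: "M > 0" "t < real M + 1" "real M \<le> t" using t unfolding M_def by linarith+
  have iff: "t < real p \<longleftrightarrow> M < p" for p :: nat unfolding M_def using t by linarith
  let ?P = "{p. prime p \<and> M < p \<and> p \<le> N}"
  have lt: "ln t > 0" using t by simp
  show ?thesis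
  proof (cases "M \<le> N")
    case False
    then have "?P = {}" by auto
    then show ?thesis using t lt by (simp only: iff) simp
  next
    case True
    have "ln t * (\<Sum>p\<in>?P. 1 / (real p)\<^sup>2) = (\<Sum>p\<in>?P. ln t / (real p)\<^sup>2)"
      by (simp add: sum_distrib_left)
    also have "\<dots> \<le> (\<Sum>p\<in>?P. ln (real p) / (real p)\<^sup>2)"
      using t by (intro sum_mono divide_right_mono) (auto simp flip: iff)
    also have "\<dots> \<le> theta N / (real N)\<^sup>2 + 2 * ln 4 * (1 / real M - 1 / real N)"
      using M True by (intro sum_ln_primes_over_square) auto
    also have "\<dots> \<le> (real N * ln 4) / (real N)\<^sup>2 + 2 * ln 4 * (1 / real M - 1 / real N)"
      by (intro add_right_mono divide_right_mono theta_upper) auto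
    also have "\<dots> = 2 * ln 4 / real M - ln 4 / real N"
      using M True by (simp add: power2_eq_square field_simps)
    also have "\<dots> \<le> 2 * ln 4 / real M" by simp
    \<comment> \<open>From M >= 1 and M > t - 1 it follows that M is at least t/2; this turns the
      constant 2 ln 4 into 4 ln 4.\<close>
    also have "\<dots> \<le> 2 * ln 4 / (t / 2)"
    proof (intro divide_left_mono)
      have "real M \<ge> 1" using M by simp
      then show "t / 2 \<le> real M" using M by linarith
    qed (use M t in auto)
    finally have "ln t * (\<Sum>p\<in>?P. 1 / (real p)\<^sup>2) \<le> 4 * ln 4 / t" by simp
    then show ?thesis using lt t by (simp add: iff field_simps)
  qed
qed

text \<open>Why the ratio 4: at 2m the lower bound has leading term m ln 4, which the upper bound at
  m cancels completely. At 4m a surplus m ln 4 >= m remains, and half of it absorbs the error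
  terms.\<close>

lemma eventually_theta_quadruple:
  "eventually (\<lambda>m. theta (4 * m) - theta m \<ge> real m / 2) sequentially"
proof -
  have ln4: "ln (4 :: real) \<ge> 1"
    using ln2_ge_two_thirds ln_realpow[of 2 2] by simp
  have "eventually (\<lambda>m::nat. ln (4 * real m) + sqrt (4 * real m) * ln (4 * real m) \<le> real m / 2) sequentially"
    by real_asymp
  then show ?thesis using eventually_gt_at_top[of 0]
  proof eventually_elim
    case (elim m)
    have "real m * 1 \<le> real m * ln 4" using ln4 by (intro mult_left_mono) auto
    moreover have "theta (4 * m) \<ge> 2 * (real m * ln 4) - (ln (4 * real m) + sqrt (4 * real m) * ln (4 * real m))"
      using theta_lower[of "2 * m"] elim by simp
    ultimately show ?case using theta_upper[of m] elim(1) by linarith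
  qed
qed

text \<open>For large t the primes between m and 4m, with m the ceiling of t, suffice. Below a fixed
  threshold T the sum is at least the one for T over the same range, and \<open>min 1\<close> keeps
  the right side bounded as t tends to 1.\<close>

lemma sum_primes_inverse_square_lower:
  "\<exists>c>0. \<forall>t>1. \<exists>N. (\<Sum>p | prime p \<and> t < real p \<and> p \<le> N. 1 / (real p)\<^sup>2) \<ge> c * min 1 (1 / (t * ln t))"
proof -
  define Q where "Q t N = (\<Sum>p | prime p \<and> t < real p \<and> p \<le> N. 1 / (real p)\<^sup>2)" for t N
  obtain m0 where m0: "\<And>m. m \<ge> m0 \<Longrightarrow> theta (4 * m) - theta m \<ge> real m / 2"
    using eventually_theta_quadruple by (auto simp: eventually_sequentially)
  have large: "Q t (4 * nat \<lceil>t\<rceil>) \<ge> (1 / 256) * (1 / (t * ln t))" if t: "t \<ge> 2" "t \<ge> real m0" for t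
  proof -
    define m where "m = nat \<lceil>t\<rceil>"
    have m: "real m \<ge> t" "real m < t + 1" "m \<ge> m0" using t unfolding m_def by linarith+
    let ?P = "{p. prime p \<and> m < p \<and> p \<le> 4 * m}"
    have lnm: "ln (4 * real m) > 0" using m t by simp
    have m2t: "real m \<le> 2 * t" using m t by simp
    have "real m / 2 \<le> theta (4 * m) - theta m" using m by (intro m0)
    also have "\<dots> = (\<Sum>p\<in>?P. ln (real p))" by (subst theta_diff) auto
    \<comment> \<open>As p <= 4m, the factor (4m)^2 / p^2 is at least 1; it trades the logarithmic
      weights for inverse squares.\<close>
    also have "\<dots> \<le> (\<Sum>p\<in>?P. ln (4 * real m) * (4 * real m)\<^sup>2 * (1 / (real p)\<^sup>2))"
    proof (intro sum_mono)
      fix p assume "p \<in> ?P"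
      then have p: "real p > 0" "real p \<le> 4 * real m" by auto
      have "ln (real p) \<le> ln (4 * real m)" using p by simp
      also have "\<dots> = ln (4 * real m) * 1" by simp
      also have "\<dots> \<le> ln (4 * real m) * ((4 * real m)\<^sup>2 / (real p)\<^sup>2)"
        using p lnm power_mono[OF p(2), of 2] by (intro mult_left_mono) auto
      finally show "ln (real p) \<le> ln (4 * real m) * (4 * real m)\<^sup>2 * (1 / (real p)\<^sup>2)" by simp
    qed
    also have "\<dots> = ln (4 * real m) * (4 * real m)\<^sup>2 * (\<Sum>p\<in>?P. 1 / (real p)\<^sup>2)"
      by (simp add: sum_distrib_left)
    also have "(\<Sum>p\<in>?P. 1 / (real p)\<^sup>2) \<le> Q t (4 * m)"
      unfolding Q_def using m by (intro sum_mono2) auto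
    finally have "real m / 2 \<le> ln (4 * real m) * (4 * real m)\<^sup>2 * Q t (4 * m)"
      using lnm by (simp add: mult_left_mono)
    then have "1 / (32 * real m * ln (4 * real m)) \<le> Q t (4 * m)"
      using lnm m t by (simp add: field_simps power2_eq_square)
    \<comment> \<open>Here m <= 2t and, since 8 <= t^3, also 4m <= t^4; so 32 m ln (4m) <= 32 * 2t *
      4 ln t.\<close>
    moreover have "32 * real m * ln (4 * real m) \<le> 256 * (t * ln t)"
    proof -
      have "4 * real m \<le> 8 * t" using m2t by simp
      also have "\<dots> = 2 ^ 3 * t" by simp
      also have "\<dots> \<le> t ^ 3 * t" using t by (intro mult_right_mono power_mono) auto
      also have "\<dots> = t ^ 4" by (simp add: eval_nat_numeral)
      finally have "ln (4 * real m) \<le> ln (t ^ 4)" using m t by (subst ln_le_cancel_iff) auto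
      also have "\<dots> = 4 * ln t" using t by (simp add: ln_realpow)
      finally have "real m * ln (4 * real m) \<le> (2 * t) * (4 * ln t)"
        using m2t lnm t by (intro mult_mono) auto
      then show ?thesis by simp
    qed
    moreover have "0 < 32 * real m * ln (4 * real m)" using m t lnm by simp
    ultimately have "1 / (256 * (t * ln t)) \<le> Q t (4 * m)"
      by (meson divide_left_mono mult_pos_pos order_trans less_le_trans zero_le_one)
    then show ?thesis by (simp add: m_def)
  qed
  define T where "T = max 2 (real m0)"
  have T: "T \<ge> 2" "T \<ge> real m0" "T * ln T > 0" unfolding T_def by auto
  \<comment> \<open>The minimum is the loss at T, so that one constant serves both ranges of
    t.\<close>
  define c where "c = (1 / 256) * min 1 (1 / (T * ln T))"
  have "\<exists>N. Q t N \<ge> c * min 1 (1 / (t * ln t))" if t: "t > 1" for t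
  proof (cases "t \<ge> T")
    case True
    have "c * min 1 (1 / (t * ln t)) \<le> (1 / 256) * (1 / (t * ln t))"
      unfolding c_def using t T by (intro mult_mono) auto
    also have "\<dots> \<le> Q t (4 * nat \<lceil>t\<rceil>)" using True T by (intro large) auto
    finally show ?thesis by blast
  next
    case False
    have "c * min 1 (1 / (t * ln t)) \<le> c * 1"
      unfolding c_def using t T by (intro mult_left_mono) auto
    also have "\<dots> \<le> (1 / 256) * (1 / (T * ln T))" unfolding c_def by simp
    also have "\<dots> \<le> Q T (4 * nat \<lceil>T\<rceil>)" using T by (intro large) auto
    also have "\<dots> \<le> Q t (4 * nat \<lceil>T\<rceil>)"
      unfolding Q_def using False by (intro sum_mono2) auto
    finally show ?thesis by blast
  qed
  moreover have "c > 0" unfolding c_def using T by auto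
  ultimately show ?thesis unfolding Q_def by blast
qed

section \<open>The Markov chain of continued fraction digits\<close>

definition cf_density :: "real \<Rightarrow> real \<Rightarrow> real" where
  "cf_density \<theta> x = (1 + \<theta>) / (1 + \<theta> * x)\<^sup>2"

text \<open>For \<theta> = 0 the density is 1, which recovers Lebesgue measure on (0,1].\<close>

definition cf_measure :: "real \<Rightarrow> real measure" where
  "cf_measure \<theta> = density lborel (\<lambda>x. ennreal (indicator {0<..1} x * cf_density \<theta> x))"

text \<open>The increment of the distribution function (1 + \<theta>) x / (1 + \<theta> x) between
  1/(k + 1) and 1/k, the points with first digit k.\<close>

definition digit_prob :: "real \<Rightarrow> nat \<Rightarrow> real" where
  "digit_prob \<theta> k = (1 + \<theta>) / ((real k + \<theta>) * (real k + 1 + \<theta>))"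

lemma cf_density_measurable [measurable]: "cf_density \<theta> \<in> borel_measurable borel"
  unfolding cf_density_def by measurable

lemma gauss_map_measurable [measurable]: "gauss_map \<in> borel_measurable borel"
  unfolding gauss_map_def frac_def by measurable

lemma gauss_map_funpow_measurable [measurable]: "(gauss_map ^^ n) \<in> borel_measurable borel"
  by (induction n) (auto intro: measurable_comp gauss_map_measurable)

lemma cf_digit_measurable [measurable]: "cf_digit n \<in> borel \<rightarrow>\<^sub>M count_space UNIV"
  unfolding cf_digit_def by measurable

lemma space_cf_measure [simp]: "space (cf_measure \<theta>) = UNIV"
  and sets_cf_measure [simp, measurable_cong]: "sets (cf_measure \<theta>) = sets borel"
  by (simp_all add: cf_measure_def)

lemma cf_digit_1: "cf_digit 1 x = nat \<lfloor>1 / x\<rfloor>"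
  by (simp add: cf_digit_def)

lemma cf_digit_Suc: "n \<ge> 1 \<Longrightarrow> cf_digit (Suc n) x = cf_digit n (gauss_map x)"
  by (cases n) (simp_all add: cf_digit_def funpow_swap1)

lemma emeasure_cf_measure:
  assumes "S \<in> sets borel"
  shows "emeasure (cf_measure \<theta>) S =
           (\<integral>\<^sup>+x. ennreal (indicator {0<..1} x * cf_density \<theta> x * indicator S x) \<partial>lborel)"
  unfolding cf_measure_def using assms
  by (subst emeasure_density) (auto intro!: nn_integral_cong split: split_indicator)

lemma emeasure_cf_measure_UNIV:
  assumes \<theta>: "\<theta> \<ge> 0"
  shows "emeasure (cf_measure \<theta>) UNIV = 1"
proof -
  have "emeasure (cf_measure \<theta>) UNIV = (\<integral>\<^sup>+x. ennreal (cf_density \<theta> x) * indicator {0..1} x \<partial>lborel)"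
    by (subst emeasure_cf_measure, simp, rule nn_integral_cong_AE)
       (use AE_lborel_singleton[of "0::real"] in eventually_elim, auto split: split_indicator)
  also have "\<dots> = ennreal ((1 + \<theta>) * 1 / (1 + \<theta> * 1) - (1 + \<theta>) * 0 / (1 + \<theta> * 0))"
  proof (rule nn_integral_FTC_Icc)
    fix x :: real assume "x \<in> {0..1}"
    then have "1 + \<theta> * x > 0" using \<theta> by (simp add: add_pos_nonneg)
    then show "((\<lambda>x. (1 + \<theta>) * x / (1 + \<theta> * x)) has_real_derivative cf_density \<theta> x) (at x)"
      unfolding cf_density_def
      by (auto intro!: derivative_eq_intros simp: power2_eq_square algebra_simps)
    show "0 \<le> cf_density \<theta> x" using \<theta> by (simp add: cf_density_def)
  qed auto
  also have "\<dots> = 1" using \<theta> by simp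
  finally show ?thesis .
qed

section \<open>Conditioning on the first digit\<close>

text \<open>Transfer of the density along the inverse branch y -> 1/(k + y), with Jacobian 1/(k +
  y)^2. Both sides equal (1 + \<theta>) / (k + \<theta> + y)^2, so the family of densities is closed
  under conditioning on a digit.\<close>

lemma cf_density_transform:
  assumes "\<theta> \<ge> 0" "k \<ge> 1" "y > 0"
  shows "cf_density \<theta> (1 / (real k + y)) * (1 / (real k + y)\<^sup>2)
           = digit_prob \<theta> k * cf_density (1 / (real k + \<theta>)) y"
proof -
  have pos: "real k + y > 0" "real k + \<theta> > 0" "real k + \<theta> + y > 0" using assms by auto
  have "cf_density \<theta> (1 / (real k + y)) * (1 / (real k + y)\<^sup>2)
      = (1 + \<theta>) / ((1 + \<theta> * (1 / (real k + y))) * (real k + y))\<^sup>2"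
    by (simp add: cf_density_def power_mult_distrib)
  also have "(1 + \<theta> * (1 / (real k + y))) * (real k + y) = real k + \<theta> + y"
    using pos by (simp add: field_simps)
  finally have 1: "cf_density \<theta> (1 / (real k + y)) * (1 / (real k + y)\<^sup>2) = (1 + \<theta>) / (real k + \<theta> + y)\<^sup>2" .
  have "1 + 1 / (real k + \<theta>) * y = (real k + \<theta> + y) / (real k + \<theta>)"
    "1 + 1 / (real k + \<theta>) = (real k + 1 + \<theta>) / (real k + \<theta>)"
    using pos by (simp_all add: field_simps)
  then have "cf_density (1 / (real k + \<theta>)) y
      = (real k + 1 + \<theta>) / (real k + \<theta>) / ((real k + \<theta> + y) / (real k + \<theta>))\<^sup>2"
    unfolding cf_density_def by simp
  also have "digit_prob \<theta> k * \<dots> = (1 + \<theta>) / (real k + \<theta> + y)\<^sup>2"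
    unfolding digit_prob_def using pos by (simp add: power2_eq_square)
  finally show ?thesis using 1 by simp
qed

text \<open>The Markov property: given first digit k, the shifted point is distributed by the same
  family with parameter 1/(k + \<theta>). This is the change of variables along one inverse branch,
  up to endpoints.\<close>

lemma emeasure_cf_digit_gauss_map:
  assumes S: "S \<in> sets borel" and \<theta>: "\<theta> \<ge> 0" and k: "k \<ge> 1"
  shows "emeasure (cf_measure \<theta>) {x. cf_digit 1 x = k \<and> gauss_map x \<in> S} =
           ennreal (digit_prob \<theta> k) * emeasure (cf_measure (1 / (real k + \<theta>))) S"
proof -
  note [measurable] = S
  \<comment> \<open>The branch y -> 1/(k + y) is decreasing, whereas
    \<open>nn_integral_substitution\<close> wants a nonnegative derivative; so it is run backwards
    with z = 1 - y, and the reflection is undone afterwards.\<close>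
  define g where "g z = 1 / (real k + 1 - z)" for z :: real
  define g' where "g' z = 1 / (real k + 1 - z)\<^sup>2" for z :: real
  define f where "f x = cf_density \<theta> x * indicator {x. gauss_map x \<in> S} x" for x
  have g01: "g 0 = 1 / (real k + 1)" "g 1 = 1 / real k" using k by (simp_all add: g_def)
  have f_meas [measurable]: "f \<in> borel_measurable borel"
    unfolding f_def by measurable
  have g_meas [measurable]: "g \<in> borel_measurable borel" "g' \<in> borel_measurable borel"
    unfolding g_def g'_def by measurable
  \<comment> \<open>The endpoint \<open>g 0\<close> = 1/(k + 1) has digit k + 1 and is excluded; the
    integral does not see it.\<close>
  have digit: "cf_digit 1 x = k \<longleftrightarrow> x \<in> {g 0..g 1}" if "x \<in> {0<..1}" "x \<noteq> g 0" for x
  proof -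
    have "cf_digit 1 x = k \<longleftrightarrow> real k \<le> 1 / x \<and> 1 / x < real k + 1"
      using k that unfolding cf_digit_1 by (auto simp: nat_eq_iff floor_eq_iff)
    also have "\<dots> \<longleftrightarrow> x \<in> {g 0<..g 1}"
      using k that by (auto simp: g01 field_simps)
    finally show ?thesis using that by auto
  qed
  have sub: "{g 0..g 1} \<subseteq> {0<..1}"
  proof -
    have "g 0 > 0" "g 1 \<le> 1" using k by (auto simp: g01)
    then show ?thesis by auto
  qed
  have "emeasure (cf_measure \<theta>) {x. cf_digit 1 x = k \<and> gauss_map x \<in> S} =
          (\<integral>\<^sup>+x. ennreal (f x * indicator {g 0..g 1} x) \<partial>lborel)"
    by (subst emeasure_cf_measure, measurable, rule nn_integral_cong_AE)
       (use AE_lborel_singleton[of "g 0"] in eventually_elim,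
         use digit sub in \<open>auto simp: f_def split: split_indicator\<close>)
  also have "\<dots> = (\<integral>\<^sup>+z. ennreal (f (g z) * g' z * indicator {0..1} z) \<partial>lborel)"
  proof (rule nn_integral_substitution)
    show "set_borel_measurable borel {g 0..g 1} f"
      unfolding set_borel_measurable_def by measurable
    show "(g has_real_derivative g' z) (at z)" if "z \<in> {0..1}" for z
      unfolding g_def [abs_def] g'_def using that k
      by (auto intro!: derivative_eq_intros simp: power2_eq_square)
    show "continuous_on {0..1} g'"
      unfolding g'_def [abs_def] using k by (intro continuous_intros) auto
  qed (auto simp: g'_def)
  also have "\<dots> = (\<integral>\<^sup>+y. ennreal (f (g (1 - y)) * g' (1 - y) * indicator {0..1} (1 - y)) \<partial>lborel)"
    by (subst nn_integral_real_affine[where c = "-1" and t = 1]) simp_all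
  also have "\<dots> = (\<integral>\<^sup>+y. ennreal (digit_prob \<theta> k) *
      ennreal (indicator {0<..1} y * cf_density (1 / (real k + \<theta>)) y * indicator S y) \<partial>lborel)"
  proof (rule nn_integral_cong_AE)
    \<comment> \<open>Both endpoints are discarded: y = 0 lies in only one of the two intervals, and
      at y = 1 the fractional part of k + y is 0.\<close>
    have "AE y in lborel. y \<noteq> 0 \<and> y \<noteq> (1::real)"
      using AE_lborel_singleton[of "0::real"] AE_lborel_singleton[of "1::real"] by eventually_elim simp
    then show "AE y in lborel. ennreal (f (g (1 - y)) * g' (1 - y) * indicator {0..1} (1 - y)) =
        ennreal (digit_prob \<theta> k) *
        ennreal (indicator {0<..1} y * cf_density (1 / (real k + \<theta>)) y * indicator S y)"
    proof eventually_elim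
      case (elim y)
      show ?case
      proof (cases "0 < y \<and> y < 1")
        case True
        have "frac (real k + y) = y" using True by (simp add: frac_unique_iff)
        then have gm: "gauss_map (g (1 - y)) = y" by (simp add: gauss_map_def g_def)
        have "f (g (1 - y)) * g' (1 - y) =
            cf_density \<theta> (1 / (real k + y)) * (1 / (real k + y)\<^sup>2) * indicator S y"
          using gm by (simp add: f_def g_def g'_def indicator_def)
        also have "\<dots> = digit_prob \<theta> k * (cf_density (1 / (real k + \<theta>)) y * indicator S y)"
          using \<theta> k True by (subst cf_density_transform) auto
        finally show ?thesis using True \<theta>
          by (subst ennreal_mult' [symmetric]) (auto simp: digit_prob_def)
      next
        case False
        then show ?thesis using elim by (auto split: split_indicator)
      qed
    qed
  qed
  also have "\<dots> = ennreal (digit_prob \<theta> k) * emeasure (cf_measure (1 / (real k + \<theta>))) S"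
    by (subst nn_integral_cmult, measurable) (simp add: emeasure_cf_measure)
  finally show ?thesis .
qed

lemma emeasure_cf_digit_eq:
  assumes "\<theta> \<ge> 0" "k \<ge> 1"
  shows "emeasure (cf_measure \<theta>) {x. cf_digit 1 x = k} = ennreal (digit_prob \<theta> k)"
  using emeasure_cf_digit_gauss_map[of UNIV \<theta> k] assms by (simp add: emeasure_cf_measure_UNIV)

text \<open>Digit 0 occurs only outside (0,1], where the measure has no mass, so sums over all
  natural k effectively start at 1.\<close>

lemma emeasure_cf_digit_0: "emeasure (cf_measure \<theta>) {x. cf_digit 1 x = 0} = 0"
proof -
  have "cf_digit 1 x \<noteq> 0" if "x \<in> {0<..1}" for x
  proof -
    have "1 \<le> 1 / x" using that by simp
    then show ?thesis unfolding cf_digit_1 by linarith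
  qed
  then have "indicator {0<..1} x * cf_density \<theta> x * indicator {x. cf_digit 1 x = 0} x = 0" for x
    by (auto split: split_indicator)
  then show ?thesis by (subst emeasure_cf_measure, measurable) (simp only:, simp)
qed

lemma emeasure_cf_digit_in_gauss_map:
  assumes S [measurable]: "S \<in> sets borel"
  shows "emeasure (cf_measure \<theta>) {x. cf_digit 1 x \<in> D \<and> gauss_map x \<in> S} =
           (\<Sum>k. if k \<in> D then emeasure (cf_measure \<theta>) {x. cf_digit 1 x = k \<and> gauss_map x \<in> S} else 0)"
proof -
  define A where "A k = (if k \<in> D then {x. cf_digit 1 x = k \<and> gauss_map x \<in> S} else {})" for k
  have "{x. cf_digit 1 x \<in> D \<and> gauss_map x \<in> S} = (\<Union>k. A k)"
    by (auto simp: A_def)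
  also have "emeasure (cf_measure \<theta>) \<dots> = (\<Sum>k. emeasure (cf_measure \<theta>) (A k))"
    by (subst suminf_emeasure) (auto simp: A_def disjoint_family_on_def)
  also have "\<dots> = (\<Sum>k. if k \<in> D then emeasure (cf_measure \<theta>) {x. cf_digit 1 x = k \<and> gauss_map x \<in> S} else 0)"
    by (intro suminf_cong) (simp add: A_def)
  finally show ?thesis .
qed

lemma emeasure_cf_digit_in:
  assumes \<theta>: "\<theta> \<ge> 0" and D: "0 \<notin> D"
  shows "emeasure (cf_measure \<theta>) {x. cf_digit 1 x \<in> D} = (\<Sum>k. ennreal (if k \<in> D then digit_prob \<theta> k else 0))"
proof -
  have "(if k \<in> D then emeasure (cf_measure \<theta>) {x. cf_digit 1 x = k} else 0)
          = ennreal (if k \<in> D then digit_prob \<theta> k else 0)" for k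
    using emeasure_cf_digit_eq[OF \<theta>, of k] D by (cases "k = 0") auto
  then show ?thesis
    using emeasure_cf_digit_in_gauss_map[of UNIV \<theta> D] by (simp only: UNIV_I simp_thms) simp
qed

text \<open>Conditioning on a first digit k >= 1 replaces \<theta> by 1/(k + \<theta>), again in
  [0,1], so a bound uniform in the parameter factors out of the sum over k.\<close>

lemma emeasure_cf_digit_in_le:
  assumes S: "S \<in> sets borel" and \<theta>: "\<theta> \<ge> 0"
    and le: "\<And>\<theta>'. 0 \<le> \<theta>' \<Longrightarrow> \<theta>' \<le> 1 \<Longrightarrow> emeasure (cf_measure \<theta>') S \<le> \<beta>"
  shows "emeasure (cf_measure \<theta>) {x. cf_digit 1 x \<in> D \<and> gauss_map x \<in> S}
           \<le> \<beta> * emeasure (cf_measure \<theta>) {x. cf_digit 1 x \<in> D}"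
proof -
  let ?A = "\<lambda>S k. emeasure (cf_measure \<theta>) {x. cf_digit 1 x = k \<and> gauss_map x \<in> S}"
  have *: "?A S k \<le> \<beta> * ?A UNIV k" for k
  proof (cases "k = 0")
    case True
    have "?A S 0 \<le> emeasure (cf_measure \<theta>) {x. cf_digit 1 x = 0}"
      by (rule emeasure_mono) auto
    then show ?thesis using True by (simp add: emeasure_cf_digit_0 del: One_nat_def)
  next
    case False
    have "?A S k = emeasure (cf_measure (1 / (real k + \<theta>))) S * ennreal (digit_prob \<theta> k)"
      using False S \<theta> by (subst emeasure_cf_digit_gauss_map) (auto simp: mult.commute)
    also have "\<dots> \<le> \<beta> * ennreal (digit_prob \<theta> k)"
      using False \<theta> by (intro mult_right_mono le) (auto simp: field_simps)
    also have "ennreal (digit_prob \<theta> k) = ?A UNIV k"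
      using False \<theta> by (simp add: emeasure_cf_digit_eq del: One_nat_def)
    finally show ?thesis .
  qed
  have "emeasure (cf_measure \<theta>) {x. cf_digit 1 x \<in> D \<and> gauss_map x \<in> S} = (\<Sum>k. if k \<in> D then ?A S k else 0)"
    using S by (rule emeasure_cf_digit_in_gauss_map)
  also have "\<dots> \<le> (\<Sum>k. \<beta> * (if k \<in> D then ?A UNIV k else 0))"
    using * by (intro suminf_le) auto
  also have "\<dots> = \<beta> * (\<Sum>k. if k \<in> D then ?A UNIV k else 0)"
    by (rule ennreal_suminf_cmult)
  also have "(\<Sum>k. if k \<in> D then ?A UNIV k else 0) = emeasure (cf_measure \<theta>) {x. cf_digit 1 x \<in> D}"
    using emeasure_cf_digit_in_gauss_map[of UNIV \<theta> D] by simp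
  finally show ?thesis .
qed

text \<open>The substitute for independence: single-digit bounds that are uniform in the parameter
  multiply along the chain. The first digit is split off and the others are digits of
  \<open>gauss_map x\<close>, so the induction keeps \<theta>, D and \<delta> arbitrary.\<close>

lemma emeasure_cf_digits_le_prod:
  fixes \<delta> :: "nat \<Rightarrow> ennreal"
  assumes "0 \<le> \<theta>" "\<theta> \<le> 1"
    and "\<And>i \<theta>'. 0 \<le> \<theta>' \<Longrightarrow> \<theta>' \<le> 1 \<Longrightarrow> emeasure (cf_measure \<theta>') {x. cf_digit 1 x \<in> D i} \<le> \<delta> i"
  shows "emeasure (cf_measure \<theta>) {x. \<forall>i<n. cf_digit (Suc i) x \<in> D i} \<le> (\<Prod>i<n. \<delta> i)"
  using assms
proof (induction n arbitrary: \<theta> D \<delta>)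
  case 0
  then show ?case by (simp add: emeasure_cf_measure_UNIV)
next
  case (Suc n)
  let ?S = "{x. \<forall>i<n. cf_digit (Suc i) x \<in> D (Suc i)}"
  have "{x. \<forall>i<Suc n. cf_digit (Suc i) x \<in> D i} = {x. cf_digit 1 x \<in> D 0 \<and> gauss_map x \<in> ?S}"
    by (auto simp: less_Suc_eq_0_disj cf_digit_Suc)
  also have "emeasure (cf_measure \<theta>) \<dots> \<le> (\<Prod>i<n. \<delta> (Suc i)) * emeasure (cf_measure \<theta>) {x. cf_digit 1 x \<in> D 0}"
    by (rule emeasure_cf_digit_in_le) (use Suc.prems in \<open>auto intro!: Suc.IH\<close>)
  also have "\<dots> \<le> (\<Prod>i<n. \<delta> (Suc i)) * \<delta> 0"
    using Suc.prems by (intro mult_left_mono) auto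
  also have "\<dots> = (\<Prod>i<Suc n. \<delta> i)"
    by (subst prod.lessThan_Suc_shift) (simp add: mult.commute)
  finally show ?case .
qed

lemma digit_prob_upper:
  assumes "0 \<le> \<theta>" "\<theta> \<le> 1" "k \<ge> 1"
  shows "digit_prob \<theta> k \<le> 2 / (real k)\<^sup>2"
  unfolding digit_prob_def power2_eq_square
  using assms by (intro frac_le mult_mono) auto

text \<open>Since \<theta> <= 1 <= k, the factors of the denominator are at most 2k and 3k, whence
  the 6.\<close>

lemma digit_prob_lower:
  assumes "0 \<le> \<theta>" "\<theta> \<le> 1" "k \<ge> 1"
  shows "digit_prob \<theta> k \<ge> (1 / 6) * (1 / (real k)\<^sup>2)"
proof -
  have "(real k + \<theta>) * (real k + 1 + \<theta>) \<le> (2 * real k) * (3 * real k)"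
    using assms by (intro mult_mono) auto
  then have "1 / ((2 * real k) * (3 * real k)) \<le> digit_prob \<theta> k"
    unfolding digit_prob_def using assms by (intro frac_le mult_pos_pos) auto
  then show ?thesis by (simp add: power2_eq_square)
qed

section \<open>Large prime digits\<close>

text \<open>By \<open>digit_prob_upper\<close> this is at most twice the sum over primes. The series
  is handled as a supremum of partial sums, because the prime estimate concerns finite ranges,
  uniformly in their length.\<close>

lemma emeasure_large_prime_digit_upper:
  assumes \<theta>: "0 \<le> \<theta>" "\<theta> \<le> 1" and t: "t > 1"
  shows "emeasure (cf_measure \<theta>) {x. cf_digit 1 x \<in> {p. prime p \<and> t < real p}}
           \<le> ennreal (8 * ln 4 / (t * ln t))"
proof -
  let ?D = "{p. prime p \<and> t < real p}"
  have "emeasure (cf_measure \<theta>) {x. cf_digit 1 x \<in> ?D} =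
          (SUP n. \<Sum>k<n. ennreal (if k \<in> ?D then digit_prob \<theta> k else 0))"
    using \<theta> by (subst emeasure_cf_digit_in) (auto simp: suminf_eq_SUP)
  also have "\<dots> \<le> ennreal (8 * ln 4 / (t * ln t))"
  proof (rule SUP_least)
    fix n
    let ?P = "{p. prime p \<and> t < real p \<and> p \<le> n}"
    have "(\<Sum>k<n. ennreal (if k \<in> ?D then digit_prob \<theta> k else 0))
            = ennreal (\<Sum>k<n. if k \<in> ?D then digit_prob \<theta> k else 0)"
      using \<theta> by (subst sum_ennreal) (auto simp: digit_prob_def)
    also have "(\<Sum>k<n. if k \<in> ?D then digit_prob \<theta> k else 0) = (\<Sum>k\<in>{k\<in>{..<n}. k \<in> ?D}. digit_prob \<theta> k)"
      by (rule sum.inter_filter [symmetric]) auto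
    also have "\<dots> \<le> (\<Sum>k\<in>?P. digit_prob \<theta> k)"
      using \<theta> by (intro sum_mono2) (auto simp: digit_prob_def)
    also have "\<dots> \<le> (\<Sum>k\<in>?P. 2 * (1 / (real k)\<^sup>2))"
      using digit_prob_upper[OF \<theta>] by (intro sum_mono) (auto dest: prime_ge_1_nat)
    also have "\<dots> = 2 * (\<Sum>k\<in>?P. 1 / (real k)\<^sup>2)"
      by (rule sum_distrib_left [symmetric])
    also have "\<dots> \<le> 2 * (4 * ln 4 / (t * ln t))"
      using sum_primes_inverse_square_upper[OF t] by (intro mult_left_mono) auto
    also have "\<dots> = 8 * ln 4 / (t * ln t)" by simp
    finally show "(\<Sum>k<n. ennreal (if k \<in> ?D then digit_prob \<theta> k else 0)) \<le> ennreal (8 * ln 4 / (t * ln t))"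
      by (simp add: ennreal_leI)
  qed
  finally show ?thesis .
qed

text \<open>One finite block of primes already carries enough mass; c / 6 combines the constant of
  the prime sum with that of \<open>digit_prob_lower\<close>.\<close>

lemma emeasure_large_prime_digit_lower:
  "\<exists>c>0. \<forall>\<theta> t. 0 \<le> \<theta> \<longrightarrow> \<theta> \<le> 1 \<longrightarrow> t > 1 \<longrightarrow>
     emeasure (cf_measure \<theta>) {x. cf_digit 1 x \<in> {p. prime p \<and> t < real p}}
       \<ge> ennreal (c * min 1 (1 / (t * ln t)))"
proof -
  obtain c where c: "c > 0" and
    N: "\<And>t. t > 1 \<Longrightarrow> \<exists>N. (\<Sum>p | prime p \<and> t < real p \<and> p \<le> N. 1 / (real p)\<^sup>2) \<ge> c * min 1 (1 / (t * ln t))"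
    using sum_primes_inverse_square_lower by blast
  have "ennreal (c / 6 * min 1 (1 / (t * ln t)))
          \<le> emeasure (cf_measure \<theta>) {x. cf_digit 1 x \<in> {p. prime p \<and> t < real p}}"
    if \<theta>: "0 \<le> \<theta>" "\<theta> \<le> 1" and t: "t > 1" for \<theta> t
  proof -
    let ?D = "{p. prime p \<and> t < real p}"
    obtain N where N: "c * min 1 (1 / (t * ln t)) \<le> (\<Sum>p | prime p \<and> t < real p \<and> p \<le> N. 1 / (real p)\<^sup>2)"
      using N[OF t] by blast
    let ?P = "{p. prime p \<and> t < real p \<and> p \<le> N}"
    have "c / 6 * min 1 (1 / (t * ln t)) = (1 / 6) * (c * min 1 (1 / (t * ln t)))" by simp
    also have "\<dots> \<le> (1 / 6) * (\<Sum>p\<in>?P. 1 / (real p)\<^sup>2)"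
      using N by (intro mult_left_mono) auto
    also have "\<dots> = (\<Sum>p\<in>?P. (1 / 6) * (1 / (real p)\<^sup>2))"
      by (rule sum_distrib_left)
    also have "\<dots> \<le> (\<Sum>p\<in>?P. digit_prob \<theta> p)"
      by (intro sum_mono digit_prob_lower \<theta>) (auto dest: prime_ge_1_nat)
    also have "\<dots> = (\<Sum>p\<in>{p\<in>{..<Suc N}. p \<in> ?D}. digit_prob \<theta> p)"
      by (intro sum.cong) auto
    also have "\<dots> = (\<Sum>k<Suc N. if k \<in> ?D then digit_prob \<theta> k else 0)"
      by (rule sum.inter_filter) auto
    finally have "ennreal (c / 6 * min 1 (1 / (t * ln t)))
        \<le> ennreal (\<Sum>k<Suc N. if k \<in> ?D then digit_prob \<theta> k else 0)"
      by (rule ennreal_leI)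
    also have "\<dots> = (\<Sum>k<Suc N. ennreal (if k \<in> ?D then digit_prob \<theta> k else 0))"
      using \<theta> by (subst sum_ennreal) (auto simp: digit_prob_def)
    also have "\<dots> \<le> (\<Sum>k. ennreal (if k \<in> ?D then digit_prob \<theta> k else 0))"
      by (rule sum_le_suminf) auto
    also have "\<dots> = emeasure (cf_measure \<theta>) {x. cf_digit 1 x \<in> ?D}"
      using \<theta> by (subst emeasure_cf_digit_in) auto
    finally show ?thesis .
  qed
  with c show ?thesis by (intro exI[of _ "c / 6"]) auto
qed

section \<open>Borel-Cantelli dichotomy for large prime digits\<close>

lemma cf_measure_0:
  assumes "S \<in> sets borel"
  shows "emeasure (cf_measure 0) S = emeasure lborel (S \<inter> {0<..1})"
  using assms
  by (subst emeasure_cf_measure)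
     (auto simp: cf_density_def simp flip: nn_integral_indicator intro!: nn_integral_cong split: split_indicator)

lemma measure_Ioc_eq_cf_measure:
  assumes "S \<in> sets borel"
  shows "measure lborel {x \<in> {0<..1}. x \<in> S} = measure (cf_measure 0) S"
proof -
  have "{x \<in> {0<..1}. x \<in> S} = S \<inter> {0<..1}" by auto
  then show ?thesis using cf_measure_0[OF assms] by (simp add: measure_def)
qed

lemma AE_finitely_many_large_prime_digits:
  fixes t :: "nat \<Rightarrow> real"
  assumes t: "\<And>n. t n > 1" and summable: "summable (\<lambda>n. 1 / (t n * ln (t n)))"
  shows "AE x in cf_measure 0. finite {n. prime (cf_digit (Suc n) x) \<and> t n < real (cf_digit (Suc n) x)}"
proof -
  define A where "A n = {x. prime (cf_digit (Suc n) x) \<and> t n < real (cf_digit (Suc n) x)}" for n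
  have A_meas [measurable]: "A n \<in> sets borel" for n
    unfolding A_def by measurable
  have emeasure_A: "emeasure (cf_measure 0) (A n) \<le> ennreal (8 * ln 4 / (t n * ln (t n)))" for n
  proof -
    \<comment> \<open>Only position n is constrained; every earlier digit is free and contributes
      the factor 1.\<close>
    let ?D = "\<lambda>i. if i = n then {p. prime p \<and> t n < real p} else UNIV"
    let ?\<delta> = "\<lambda>i. if i = n then ennreal (8 * ln 4 / (t n * ln (t n))) else 1"
    have "emeasure (cf_measure 0) (A n) = emeasure (cf_measure 0) {x. \<forall>i<Suc n. cf_digit (Suc i) x \<in> ?D i}"
      unfolding A_def by (rule arg_cong[where f = "emeasure _"]) auto
    also have "\<dots> \<le> (\<Prod>i<Suc n. ?\<delta> i)"
      using emeasure_large_prime_digit_upper[OF _ _ t[of n]]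
      by (intro emeasure_cf_digits_le_prod) (auto simp: emeasure_cf_measure_UNIV)
    also have "\<dots> = ennreal (8 * ln 4 / (t n * ln (t n)))"
      by (subst prod.lessThan_Suc) (simp add: prod.neutral)
    finally show ?thesis .
  qed
  have pos: "t n * ln (t n) > 0" for n using t[of n] by simp
  have "AE x in cf_measure 0. eventually (\<lambda>n. x \<in> space (cf_measure 0) - A n) sequentially"
  proof (rule borel_cantelli_AE1)
    show "emeasure (cf_measure 0) (A n) < \<infinity>" for n
      using emeasure_A[of n] by (simp add: le_less_trans)
    have "measure (cf_measure 0) (A n) \<le> 8 * ln 4 * (1 / (t n * ln (t n)))" for n
      using emeasure_A[of n] pos[of n] unfolding measure_def
      by (intro enn2real_leI) (auto simp: less_imp_le)
    then show "summable (\<lambda>n. measure (cf_measure 0) (A n))"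
      by (intro summable_comparison_test'[OF summable_mult[OF summable]]) auto
  qed auto
  then show ?thesis
  proof eventually_elim
    case (elim x)
    then obtain m where "\<And>n. n \<ge> m \<Longrightarrow> x \<notin> A n" by (auto simp: eventually_sequentially)
    then have "{n. x \<in> A n} \<subseteq> {..<m}" by (auto simp: not_le [symmetric])
    then show ?case using finite_subset by (auto simp: A_def)
  qed
qed

text \<open>A second Borel-Cantelli argument with conditional lower bounds in place of independence:
  missing the large primes at all positions from m up to n - 1 has probability at most exp of minus
  a partial sum of a divergent series.\<close>

lemma AE_infinitely_many_large_prime_digits:
  fixes t :: "nat \<Rightarrow> real"
  assumes t: "\<And>n. t n > 1" and not_summable: "\<not> summable (\<lambda>n. 1 / (t n * ln (t n)))"
  shows "AE x in cf_measure 0. infinite {n. prime (cf_digit (Suc n) x) \<and> t n < real (cf_digit (Suc n) x)}"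
proof -
  obtain c where c: "c > 0" and lower: "\<And>\<theta> t. \<lbrakk>0 \<le> \<theta>; \<theta> \<le> 1; t > 1\<rbrakk> \<Longrightarrow>
      emeasure (cf_measure \<theta>) {x. cf_digit 1 x \<in> {p. prime p \<and> t < real p}} \<ge> ennreal (c * min 1 (1 / (t * ln t)))"
    using emeasure_large_prime_digit_lower by blast
  \<comment> \<open>A lower bound for the probability of a large prime at position n, valid for
    every past.\<close>
  define q where "q n = c * min 1 (1 / (t n * ln (t n)))" for n
  define L where "L n = {p. prime p \<and> t n < real p}" for n
  have pos: "t n * ln (t n) > 0" for n using t[of n] by simp
  have q_pos: "q n > 0" for n using c pos[of n] by (simp add: q_def)
  have digit: "emeasure (cf_measure \<theta>) {x. cf_digit 1 x \<in> - L n} \<le> ennreal (exp (- q n))"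
    if \<theta>: "0 \<le> \<theta>" "\<theta> \<le> 1" for \<theta> n
  proof -
    have "{x. cf_digit 1 x \<in> - L n} = space (cf_measure \<theta>) - {x. cf_digit 1 x \<in> L n}" by auto
    also have "emeasure (cf_measure \<theta>) \<dots> = 1 - emeasure (cf_measure \<theta>) {x. cf_digit 1 x \<in> L n}"
    proof (subst emeasure_compl)
      have "emeasure (cf_measure \<theta>) {x. cf_digit 1 x \<in> L n} \<le> emeasure (cf_measure \<theta>) UNIV"
        by (intro emeasure_mono) auto
      then show "emeasure (cf_measure \<theta>) {x. cf_digit 1 x \<in> L n} \<noteq> \<infinity>"
        using \<theta> by (auto simp: emeasure_cf_measure_UNIV top_unique)
    qed (use \<theta> in \<open>simp_all add: emeasure_cf_measure_UNIV\<close>)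
    also have "\<dots> \<le> 1 - ennreal (q n)"
      using lower[OF \<theta> t[of n]] by (intro ennreal_minus_mono) (auto simp: q_def L_def)
    \<comment> \<open>Subtraction in \<open>ennreal\<close> truncates at 0, as does the embedding on
      negative reals, so the identity also covers q n > 1.\<close>
    also have "\<dots> = ennreal (1 - q n)"
      using q_pos[of n] by (simp add: ennreal_minus flip: ennreal_1)
    also have "\<dots> \<le> ennreal (exp (- q n))"
      using exp_ge_add_one_self[of "- q n"] by (intro ennreal_leI) simp
    finally show ?thesis .
  qed
  \<comment> \<open>Capping preserves divergence: were q summable, q n < c would hold eventually,
    and there q n is c times the original term.\<close>
  have not_summable_q: "\<not> summable q"
  proof
    assume "summable q"
    then have "q \<longlonglongrightarrow> 0" by (rule summable_LIMSEQ_zero)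
    then have "eventually (\<lambda>n. q n < c) sequentially" using c by (rule order_tendstoD)
    then have "eventually (\<lambda>n. norm (1 / (t n * ln (t n))) \<le> 1 / c * q n) sequentially"
    proof eventually_elim
      case (elim n)
      then show ?case using c pos[of n] by (auto simp: q_def min_def split: if_splits)
    qed
    moreover have "summable (\<lambda>n. 1 / c * q n)" using \<open>summable q\<close> by (rule summable_mult)
    ultimately have "summable (\<lambda>n. 1 / (t n * ln (t n)))" by (rule summable_comparison_test_ev)
    with not_summable show False ..
  qed
  have null: "emeasure (cf_measure 0) {x. \<forall>i\<ge>m. cf_digit (Suc i) x \<notin> L i} = 0" (is "emeasure _ ?B = 0") for m
  proof -
    \<comment> \<open>Digits before position m are free, with r i = 0 and factor exp 0 = 1.\<close>
    let ?D = "\<lambda>i. if i < m then UNIV else - L i"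
    define r where "r i = (if i < m then 0 else q i)" for i
    have bound: "emeasure (cf_measure 0) ?B \<le> ennreal (exp (- (\<Sum>i<n. r i)))" for n
    proof -
      have "emeasure (cf_measure 0) ?B \<le> emeasure (cf_measure 0) {x. \<forall>i<n. cf_digit (Suc i) x \<in> ?D i}"
        by (intro emeasure_mono) auto
      also have "\<dots> \<le> (\<Prod>i<n. ennreal (exp (- r i)))"
        using digit by (intro emeasure_cf_digits_le_prod) (auto simp: r_def emeasure_cf_measure_UNIV)
      also have "\<dots> = ennreal (exp (- (\<Sum>i<n. r i)))"
        by (simp add: prod_ennreal exp_sum flip: sum_negf)
      finally show ?thesis .
    qed
    have "\<not> summable r"
    proof -
      have "eventually (\<lambda>n. r n = q n) sequentially"
        using eventually_ge_at_top[of m] by eventually_elim (simp add: r_def)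
      then show ?thesis using not_summable_q summable_cong by blast
    qed
    have "eventually (\<lambda>n. Z \<le> (\<Sum>i<n. r i)) sequentially" for Z
    proof -
      have r_nonneg: "0 \<le> r i" for i using q_pos[of i] by (simp add: r_def)
      then obtain N where N: "Z < (\<Sum>i<N. r i)"
        using summableI_nonneg_bounded[of r Z] \<open>\<not> summable r\<close> by (meson not_le)
      have "(\<Sum>i<N. r i) \<le> (\<Sum>i<n. r i)" if "n \<ge> N" for n
        using that r_nonneg by (intro sum_mono2) auto
      with N show ?thesis
        unfolding eventually_sequentially by (meson less_imp_le order_trans)
    qed
    then have "filterlim (\<lambda>n. \<Sum>i<n. r i) at_top sequentially"
      by (simp add: filterlim_at_top)
    then have "((\<lambda>n. exp (- (\<Sum>i<n. r i))) \<longlongrightarrow> 0) sequentially"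
      by (intro filterlim_compose[OF exp_at_bot] filterlim_compose[OF filterlim_uminus_at_bot_at_top])
    then have "((\<lambda>n. ennreal (exp (- (\<Sum>i<n. r i)))) \<longlongrightarrow> ennreal 0) sequentially"
      by (rule tendsto_ennrealI)
    then have "emeasure (cf_measure 0) ?B \<le> ennreal 0"
      by (rule tendsto_lowerbound) (use bound in auto)
    then show ?thesis by simp
  qed
  have "AE x in cf_measure 0. \<forall>m. \<not> (\<forall>i\<ge>m. cf_digit (Suc i) x \<notin> L i)"
    unfolding AE_all_countable
  proof
    fix m
    show "AE x in cf_measure 0. \<not> (\<forall>i\<ge>m. cf_digit (Suc i) x \<notin> L i)"
      by (rule AE_I[OF _ null[of m]]) auto
  qed
  then show ?thesis
    by eventually_elim (auto simp: infinite_nat_iff_unbounded_le L_def)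
qed

section \<open>Prime digits and their running maxima\<close>

text \<open>Digits are numbered from 1, the series and the almost-everywhere lemmas from 0.\<close>

lemma infinite_ge_1_iff: "infinite {n. n \<ge> 1 \<and> P n} \<longleftrightarrow> infinite {n. P (Suc n)}"
proof -
  have "{n. n \<ge> 1 \<and> P n} = Suc ` {n. P (Suc n)}"
    by (auto simp: Suc_le_eq gr0_conv_Suc)
  then show ?thesis by (simp add: finite_image_iff)
qed

text \<open>Positivity of t matters: a non-prime digit is recorded as 0, which cannot exceed
  t.\<close>

lemma cf_prime_digit_gt_iff:
  assumes "t > 0"
  shows "real (cf_prime_digit n x) > t \<longleftrightarrow> prime (cf_digit n x) \<and> t < real (cf_digit n x)"
  using assms by (simp add: cf_prime_digit_def)

lemma cf_prime_digit_measurable [measurable]: "cf_prime_digit n \<in> borel \<rightarrow>\<^sub>M count_space UNIV"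
  unfolding cf_prime_digit_def by measurable

lemma cf_prime_max_gt_iff:
  assumes "n \<ge> 1"
  shows "real (cf_prime_max n x) > t \<longleftrightarrow> (\<exists>k\<in>{1..n}. real (cf_prime_digit k x) > t)"
proof -
  let ?A = "(\<lambda>k. cf_prime_digit k x) ` {1..n}"
  have A: "finite ?A" "?A \<noteq> {}" using assms by auto
  have "cf_prime_max n x \<in> ?A" unfolding cf_prime_max_def using A by (rule Max_in)
  moreover have "cf_prime_digit k x \<le> cf_prime_max n x" if "k \<in> {1..n}" for k
    unfolding cf_prime_max_def using A that by (intro Max_ge) auto
  ultimately show ?thesis
    by (auto intro: less_le_trans[of t _ "real (cf_prime_max n x)"])
qed

lemma cf_prime_max_gt_in_borel:
  assumes "n \<ge> 1"
  shows "{x. real (cf_prime_max n x) > t} \<in> sets borel"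
proof -
  have [measurable]: "{x. real (cf_prime_digit k x) > t} \<in> sets borel" for k
    by measurable
  have "{x. real (cf_prime_max n x) > t} = (\<Union>k\<in>{1..n}. {x. real (cf_prime_digit k x) > t})"
    using cf_prime_max_gt_iff[OF assms] by auto
  also have "\<dots> \<in> sets borel"
    by (intro sets.finite_UN) auto
  finally show ?thesis .
qed

text \<open>Suppose only finitely many prime digits exceed their threshold, and let A bound them. A
  maximum above b n comes from some k <= n whose digit exceeds b n >= b k, hence from one of these;
  so b n < A, which fails once b has passed A.\<close>

lemma infinite_cf_prime_max_imp_infinite_cf_prime_digit:
  assumes mono: "\<forall>n\<ge>1. b n \<le> b (Suc n)" and unbounded: "\<And>B. \<exists>n\<ge>1. b n > B"
    and inf: "infinite {n. n \<ge> 1 \<and> real (cf_prime_max n x) > b n}"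
  shows "infinite {n. n \<ge> 1 \<and> real (cf_prime_digit n x) > b n}"
proof
  let ?K = "{n. n \<ge> 1 \<and> real (cf_prime_digit n x) > b n}"
  assume fin: "finite ?K"
  have le: "b m \<le> b n" if "1 \<le> m" "m \<le> n" for m n
    using that(2) by (induction n rule: dec_induct) (use mono that in \<open>auto intro: order_trans\<close>)
  \<comment> \<open>The sum is a common upper bound that also makes sense for an empty index
    set.\<close>
  define A where "A = (\<Sum>k\<in>?K. real (cf_prime_digit k x))"
  have A: "real (cf_prime_digit k x) \<le> A" if "k \<in> ?K" for k
    unfolding A_def using fin that by (intro member_le_sum) auto
  obtain N where N: "N \<ge> 1" "b N > A" using unbounded by blast
  have "n < N" if n: "n \<ge> 1" "real (cf_prime_max n x) > b n" for n
  proof (rule ccontr)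
    assume "\<not> n < N"
    obtain k where k: "k \<in> {1..n}" "real (cf_prime_digit k x) > b n"
      using n cf_prime_max_gt_iff by blast
    then have "k \<in> ?K" using le[of k n] by auto
    then show False using A[of k] N le[of N n] k \<open>\<not> n < N\<close> by simp
  qed
  then have "{n. n \<ge> 1 \<and> real (cf_prime_max n x) > b n} \<subseteq> {..<N}" by auto
  then show False using inf finite_subset by blast
qed

theorem theorem2p1:
  fixes b :: "nat \<Rightarrow> real"
  assumes b_gt1: "\<forall>n\<ge>1. b n > 1"
  shows "measure lborel {x \<in> {0<..1}. infinite {n. n \<ge> 1 \<and> real (cf_prime_digit n x) > b n}}
           = (if \<not> summable (\<lambda>n. 1 / (b (Suc n) * ln (b (Suc n)))) then 1 else 0)
       \<and> ((\<forall>n\<ge>1. b n \<le> b (Suc n)) \<longrightarrow>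
           measure lborel {x \<in> {0<..1}. infinite {n. n \<ge> 1 \<and> real (cf_prime_digit n x) > b n}}
         = measure lborel {x \<in> {0<..1}. infinite {n. n \<ge> 1 \<and> real (cf_prime_max n x) > b n}})"
proof -
  let ?D = "\<lambda>x. infinite {n. n \<ge> 1 \<and> real (cf_prime_digit n x) > b n}"
  let ?M = "\<lambda>x. infinite {n. n \<ge> 1 \<and> real (cf_prime_max n x) > b n}"
  let ?s = "\<lambda>n. 1 / (b (Suc n) * ln (b (Suc n)))"
  have t: "b (Suc n) > 1" for n using b_gt1 by simp
  have D_iff: "?D x \<longleftrightarrow> infinite {n. prime (cf_digit (Suc n) x) \<and> b (Suc n) < real (cf_digit (Suc n) x)}" for x
    unfolding infinite_ge_1_iff using t less_trans[OF zero_less_one t]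
    by (subst cf_prime_digit_gt_iff) auto
  have D_meas: "{x. ?D x} \<in> sets borel"
    unfolding D_iff infinite_nat_iff_unbounded_le by measurable
  have M_meas: "{x. ?M x} \<in> sets borel"
  proof -
    \<comment> \<open>The shift avoids index 0, where the maximum would be over the empty
      set.\<close>
    define A where "A n = {x. real (cf_prime_max (Suc n) x) > b (Suc n)}" for n
    have [measurable]: "A n \<in> sets borel" for n
      unfolding A_def by (intro cf_prime_max_gt_in_borel) simp
    have "{x. ?M x} = (\<Inter>m. \<Union>n\<in>{m..}. A n)"
      unfolding infinite_ge_1_iff A_def by (auto simp: infinite_nat_iff_unbounded_le)
    then show ?thesis by simp
  qed
  have D_eq: "measure lborel {x \<in> {0<..1}. ?D x} = measure (cf_measure 0) {x. ?D x}"
    using measure_Ioc_eq_cf_measure[OF D_meas] by simp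
  have M_eq: "measure lborel {x \<in> {0<..1}. ?M x} = measure (cf_measure 0) {x. ?M x}"
    using measure_Ioc_eq_cf_measure[OF M_meas] by simp
  have prob_UNIV: "measure (cf_measure 0) UNIV = 1"
    by (simp add: measure_def emeasure_cf_measure_UNIV)
  have D_imp_M: "?M x" if "?D x" for x
  proof -
    have "{n. n \<ge> 1 \<and> real (cf_prime_digit n x) > b n} \<subseteq> {n. n \<ge> 1 \<and> real (cf_prime_max n x) > b n}"
    proof (intro Collect_mono impI, elim conjE, intro conjI)
      fix n :: nat assume n: "n \<ge> 1" "real (cf_prime_digit n x) > b n"
      then have "n \<in> {1..n}" by simp
      with n show "real (cf_prime_max n x) > b n"
        unfolding cf_prime_max_gt_iff[OF n(1)] by blast
    qed
    then show ?thesis using that infinite_super by blast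
  qed
  have measure_1: "measure (cf_measure 0) {x. P x} = 1"
    if "AE x in cf_measure 0. P x" "{x. P x} \<in> sets borel" for P
  proof -
    have "measure (cf_measure 0) {x. P x} = measure (cf_measure 0) UNIV"
      using that by (intro measure_eq_AE) auto
    then show ?thesis by (simp add: prob_UNIV)
  qed
  have divergent: "measure (cf_measure 0) {x. ?D x} = 1" "measure (cf_measure 0) {x. ?M x} = 1"
    if "\<not> summable ?s"
  proof -
    have AE: "AE x in cf_measure 0. ?D x"
      unfolding D_iff using t that by (rule AE_infinitely_many_large_prime_digits)
    then show "measure (cf_measure 0) {x. ?D x} = 1" using D_meas by (rule measure_1)
    have "AE x in cf_measure 0. ?M x"
      using AE by eventually_elim (rule D_imp_M)
    then show "measure (cf_measure 0) {x. ?M x} = 1" using M_meas by (rule measure_1)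
  qed
  have convergent: "measure (cf_measure 0) {x. ?D x} = 0" if "summable ?s"
  proof -
    have "AE x in cf_measure 0. \<not> ?D x"
      using AE_finitely_many_large_prime_digits[OF t that] unfolding D_iff by simp
    then have "measure (cf_measure 0) {x. ?D x} = measure (cf_measure 0) {}"
      using D_meas by (intro measure_eq_AE) auto
    then show ?thesis by simp
  qed
  have "measure lborel {x \<in> {0<..1}. ?D x} = measure lborel {x \<in> {0<..1}. ?M x}"
    if mono: "\<forall>n\<ge>1. b n \<le> b (Suc n)"
  \<comment> \<open>For unbounded b the two events are equal. If b <= B, the terms of the series
    stay above 1/(B ln B), so it diverges and both events have measure 1.\<close>
  proof (cases "\<forall>B. \<exists>n\<ge>1. b n > B")
    case True
    then have "?D x \<longleftrightarrow> ?M x" for x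
      using D_imp_M infinite_cf_prime_max_imp_infinite_cf_prime_digit[OF mono] by blast
    then show ?thesis by simp
  next
    case False
    then obtain B where B: "\<And>n. n \<ge> 1 \<Longrightarrow> b n \<le> B" by (auto simp: not_less)
    have "\<not> summable ?s"
    proof
      assume "summable ?s"
      then have lim: "?s \<longlonglongrightarrow> 0" by (rule summable_LIMSEQ_zero)
      have "1 / (B * ln B) \<le> ?s n" for n
      proof (rule frac_le)
        show "b (Suc n) * ln (b (Suc n)) \<le> B * ln B"
          using t[of n] B[of "Suc n"] by (intro mult_mono) auto
        show "0 < b (Suc n) * ln (b (Suc n))" using t[of n] by simp
      qed auto
      then have "1 / (B * ln B) \<le> 0" by (intro LIMSEQ_le_const[OF lim] exI[of _ 0] allI impI)
      \<comment> \<open>That b 1 > 1 forces B > 1 makes 1/(B ln B) a genuine positive number rather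
        than a division by 0.\<close>
      moreover have "B > 1" using t[of 0] B[of 1] by simp
      then have "B * ln B > 0" by simp
      then have "1 / (B * ln B) > 0" by (rule divide_pos_pos[OF zero_less_one])
      ultimately show False by linarith
    qed
    then show ?thesis unfolding D_eq M_eq divergent(1)[OF \<open>\<not> summable ?s\<close>]
      by (rule divergent(2)[symmetric])
  qed
  moreover have "measure lborel {x \<in> {0<..1}. ?D x} = (if \<not> summable ?s then 1 else 0)"
  proof (cases "summable ?s")
    case True
    show ?thesis unfolding D_eq convergent[OF True] using True by simp
  next
    case False
    show ?thesis unfolding D_eq divergent(1)[OF False] using False by (rule if_P[symmetric])
  qed
  ultimately show ?thesis by blast
qed

end
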